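(* Let $G$ be a ribbon graph and let $A\subseteq E(G)$. Then the partial dual $G^{A}$ is Eulerian if and only if there is a crossing-total direction of the medial graph $G_m$ of $G$ such that $A$ is the union of the set of all $d$-edges and a (possibly empty, possibly full) subset of the set of $t$-edges arising from this crossing-total direction.
   Context: Graphs are finite, not necessarily connected, and may have loops and multiple edges. A graph is Eulerian if every vertex has even degree (number of incident half-edges; connectedness is not required). Ribbon graph. A ribbon graph $G=(V(G),E(G))$ is a (possibly non-orientable) surface with boundary represented as the union of two sets of topological discs, a set $V(G)$ of vertices and a set $E(G)$ of edges, such that: the vertices and edges intersect in disjoint line segments (common line segments); each such line segment lies on the boundary of precisely one vertex and precisely one edge; every edge contains exactly two such line segments. Removing the two common line segments from the boundary of an edge disc leaves its two edge line segments. Ribbon graphs are equivalent to graphs cellularly embedded in closed surfaces (gluing a disc to each boundary component gives the surface; the glued discs are the faces), and one moves freely between the two. Arrow presentation. An arrow presentation is a set of circles with labelled arrows on them, exactly two arrows for each label. It determines a ribbon graph: each circle is the boundary of a vertex disc; for each label $e$ take an edge disc, orient its boundary, place two disjoint arrows on its boundary pointing in the direction of the orientation, and identify these with the two $e$-labelled arrows. Partial dual. Let $A\subseteq E(G)$. Arbitrarily orient (the boundary of) and label each edge disc of $G$. The boundary components of the spanning ribbon subgraph $(V(G),A)$ meet the edges of $G$ in disjoint arcs (for $e\in A$ the two edge line segments of $e$; for $e\notin A$ the two common line segments of $e$). On each of these arcs place an arrow pointing in the direction of the orientation of the edge boundary, labelled by the edge it meets. The resulting arrow presentation determines the partial dual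 $G^A$. Medial graph. For $G$ cellularly embedded in $\Sigma$, the medial graph $G_m$ is the 4-regular graph embedded in $\Sigma$ obtained by placing a vertex $v(e)$ on each edge $e$ of $G$ and, for each face $f$ with boundary $v_1e_1v_2e_2\cdots v_{d}e_{d}$, drawing edges $(v(e_1),v(e_2)),(v(e_2),v(e_3)),\dots,(v(e_d),v(e_1))$ without intersections inside $f$ following its boundary (so edges of $G_m$ correspond to the corners of $G$). The canonical checkerboard colouring of $G_m$ colours black the faces of $G_m$ containing a vertex of $G$ and white the remaining faces; around each $v(e)$ the four corners are alternately black and white. Crossing-total direction. A crossing-total direction of $G_m$ is an orientation of the edges of $G_m$ such that at each vertex $v(e)$ the four incident half-edges are, in cyclic order around $v(e)$, oriented "in, in, out, out", or "in, in, in, in", or "out, out, out, out". In the first case $v(e)$ is a $c$-vertex if the two incoming half-edges bound a black corner at $v(e)$ (equivalently, so do the two outgoing ones), and a $d$-vertex if the two incoming half-edges bound a white corner at $v(e)$. In the last two cases $v(e)$ is a $t$-vertex. The edge $e$ of $G$ is a $c$-edge, $d$-edge or $t$-edge according to the type of $v(e)$. *)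

theory Defs
  imports Main
begin

text \<open>
  A ribbon graph is recorded through the points (flags) at which a common line segment meets an
  edge line segment.  The flags cut the boundaries of all discs into segments of three kinds, and
  each kind pairs up the flags:
  \<^item> \<open>cseg\<close> exchanges the two ends of a common line segment,
  \<^item> \<open>eseg\<close> exchanges the two ends of an edge line segment,
  \<^item> \<open>vseg\<close> exchanges the two ends of an arc of a vertex boundary that lies between two
    consecutive common line segments (a corner).

  The boundary of an edge disc is the 4-cycle \<open>x, cseg x, eseg (cseg x), eseg x\<close>.  Vertex discs
  without common line segments carry no flags and are listed separately in \<open>bare\<close>.
\<close>

record ('f, 'v) ribbon_graph =
  flags :: "'f set"
  cseg :: "'f \<Rightarrow> 'f"
  eseg :: "'f \<Rightarrow> 'f"
  vseg :: "'f \<Rightarrow> 'f"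
  bare :: "'v set"

definition pairing_on :: "'a set \<Rightarrow> ('a \<Rightarrow> 'a) \<Rightarrow> bool" where
  "pairing_on X f \<longleftrightarrow> (\<forall>x\<in>X. f x \<in> X \<and> f x \<noteq> x \<and> f (f x) = x)"

definition is_ribbon_graph :: "('f, 'v) ribbon_graph \<Rightarrow> bool" where
  "is_ribbon_graph G \<longleftrightarrow>
     finite (flags G) \<and> finite (bare G) \<and>
     pairing_on (flags G) (cseg G) \<and>
     pairing_on (flags G) (eseg G) \<and>
     pairing_on (flags G) (vseg G) \<and>
     (\<forall>x\<in>flags G. cseg G (eseg G x) = eseg G (cseg G x) \<and> cseg G x \<noteq> eseg G x)"

text \<open>The closed curve through \<open>x\<close> formed by the segments of two kinds.\<close>

definition circle :: "('a \<Rightarrow> 'a) \<Rightarrow> ('a \<Rightarrow> 'a) \<Rightarrow> 'a \<Rightarrow> 'a set" where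
  "circle f g x = {y. (\<lambda>u w. w = f u \<or> w = g u)\<^sup>*\<^sup>* x y}"

definition verts :: "('f, 'v) ribbon_graph \<Rightarrow> ('f set + 'v) set" where
  "verts G = Inl ` (circle (cseg G) (vseg G) ` flags G) \<union> Inr ` bare G"

definition vertex_flags :: "'f set + 'v \<Rightarrow> 'f set" where
  "vertex_flags v = (case v of Inl c \<Rightarrow> c | Inr _ \<Rightarrow> {})"

definition edge_of :: "('f, 'v) ribbon_graph \<Rightarrow> 'f \<Rightarrow> 'f set" where
  "edge_of G x = {x, cseg G x, eseg G x, eseg G (cseg G x)}"

definition edges :: "('f, 'v) ribbon_graph \<Rightarrow> 'f set set" where
  "edges G = edge_of G ` flags G"

text \<open>Half-edges are identified with common line segments, so a loop has two of them.\<close>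

definition half_edge :: "('f, 'v) ribbon_graph \<Rightarrow> 'f \<Rightarrow> 'f set" where
  "half_edge G x = {x, cseg G x}"

definition half_edges :: "('f, 'v) ribbon_graph \<Rightarrow> 'f set set" where
  "half_edges G = half_edge G ` flags G"

definition degree :: "('f, 'v) ribbon_graph \<Rightarrow> 'f set + 'v \<Rightarrow> nat" where
  "degree G v = card {h \<in> half_edges G. h \<subseteq> vertex_flags v}"

definition eulerian :: "('f, 'v) ribbon_graph \<Rightarrow> bool" where
  "eulerian G \<longleftrightarrow> (\<forall>v\<in>verts G. even (degree G v))"


text \<open>
  An arrow presentation, recorded through the end points of its arrows: \<open>other_end\<close> exchanges the
  two ends of an arrow, \<open>arc\<close> the two ends of an arc between consecutive arrows on a circle, and
  \<open>heads\<close> are the end points that are heads.  The circles without arrows are listed in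
  \<open>bare_circles\<close>.
\<close>

record ('p, 'l, 'v) arrow_presentation =
  ends :: "'p set"
  other_end :: "'p \<Rightarrow> 'p"
  arc :: "'p \<Rightarrow> 'p"
  heads :: "'p set"
  label :: "'p \<Rightarrow> 'l"
  bare_circles :: "'v set"

text \<open>
  Both arrows with label \<open>e\<close> follow the orientation of the boundary of the edge disc \<open>e\<close>, so the
  remaining two boundary segments of that disc join the head of either arrow to the tail of the
  other one.
\<close>

definition ribbon_of_arrows :: "('p, 'l, 'v) arrow_presentation \<Rightarrow> ('p, 'v) ribbon_graph" where
  "ribbon_of_arrows P =
    \<lparr> flags = ends P,
      cseg = other_end P,
      eseg = (\<lambda>p. THE q. q \<in> ends P \<and> label P q = label P p \<and>
                q \<noteq> p \<and> q \<noteq> other_end P p \<and> (q \<in> heads P \<longleftrightarrow> p \<notin> heads P)),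
      vseg = arc P,
      bare = bare_circles P \<rparr>"

text \<open>
  An orientation of the boundaries of all edge discs, given by the set of flags at which the
  oriented boundary enters a common line segment (from \<open>x\<close> to \<open>cseg x\<close>); at the other flags it
  enters an edge line segment (from \<open>x\<close> to \<open>eseg x\<close>).
\<close>

definition edge_orientation :: "('f, 'v) ribbon_graph \<Rightarrow> 'f set \<Rightarrow> bool" where
  "edge_orientation G T \<longleftrightarrow> T \<subseteq> flags G \<and>
     (\<forall>x\<in>flags G. (cseg G x \<in> T \<longleftrightarrow> x \<notin> T) \<and> (eseg G x \<in> T \<longleftrightarrow> x \<notin> T))"

text \<open>
  The boundary of the spanning ribbon subgraph with edge set \<open>A\<close> consists of all corners, the edge
  line segments of the edges in \<open>A\<close>, the common line segments of the edges not in \<open>A\<close>, and the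
  boundaries of the bare vertices.
\<close>

definition dual_arrows ::
  "('f, 'v) ribbon_graph \<Rightarrow> 'f set \<Rightarrow> 'f set set \<Rightarrow> ('f, 'f set, 'v) arrow_presentation" where
  "dual_arrows G T A =
    \<lparr> ends = flags G,
      other_end = (\<lambda>x. if edge_of G x \<in> A then eseg G x else cseg G x),
      arc = vseg G,
      heads = {x \<in> flags G. if edge_of G x \<in> A then x \<in> T else x \<notin> T},
      label = edge_of G,
      bare_circles = bare G \<rparr>"

definition partial_dual ::
  "('f, 'v) ribbon_graph \<Rightarrow> 'f set \<Rightarrow> 'f set set \<Rightarrow> ('f, 'v) ribbon_graph" where
  "partial_dual G T A = ribbon_of_arrows (dual_arrows G T A)"


text \<open>
  The medial graph as a ribbon graph.  Its edges are the corners \<open>{x, vseg x}\<close> of \<open>G\<close> and its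
  half-edges are therefore indexed by the flags of \<open>G\<close>; around \<open>v(e)\<close> they follow the four flags of
  the edge disc \<open>e\<close>.  The flag \<open>(x, a)\<close> lies on the side of the half-edge \<open>x\<close> facing a vertex
  (\<open>a = Black\<close>) or a face (\<open>a = White\<close>) of \<open>G\<close>: at \<open>v(e)\<close>, the half-edges \<open>x\<close> and \<open>cseg x\<close> bound a
  corner containing a common line segment, and \<open>x\<close> and \<open>eseg x\<close> one containing an edge line segment.
\<close>

datatype colour = Black | White

fun flip :: "colour \<Rightarrow> colour" where
  "flip Black = White"
| "flip White = Black"

definition medial_graph :: "('f, 'v) ribbon_graph \<Rightarrow> ('f \<times> colour, 'v) ribbon_graph" where
  "medial_graph G =
    \<lparr> flags = flags G \<times> UNIV,
      cseg = (\<lambda>(x, a). (x, flip a)),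
      eseg = (\<lambda>(x, a). (vseg G x, a)),
      vseg = (\<lambda>(x, a). case a of Black \<Rightarrow> (cseg G x, Black) | White \<Rightarrow> (eseg G x, White)),
      bare = {} \<rparr>"

definition medial_vertex :: "'f set \<Rightarrow> ('f \<times> colour) set + 'v" where
  "medial_vertex e = Inl (e \<times> UNIV)"

definition faces :: "('f, 'v) ribbon_graph \<Rightarrow> 'f set set" where
  "faces G = circle (eseg G) (vseg G) ` flags G"

text \<open>
  The face of the medial graph containing the vertex \<open>v\<close> of \<open>G\<close> is the one whose boundary runs along
  the black sides of the corners at \<open>v\<close>.
\<close>

definition black_faces :: "('f, 'v) ribbon_graph \<Rightarrow> ('f \<times> colour) set set" where
  "black_faces G = {F \<in> faces (medial_graph G). \<exists>v\<in>verts G. F = vertex_flags v \<times> {Black}}"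

definition white_faces :: "('f, 'v) ribbon_graph \<Rightarrow> ('f \<times> colour) set set" where
  "white_faces G = faces (medial_graph G) - black_faces G"


text \<open>A direction of the edges, given by the set of those half-edges that leave their vertex.\<close>

definition direction :: "('f, 'v) ribbon_graph \<Rightarrow> 'f set set \<Rightarrow> bool" where
  "direction H D \<longleftrightarrow> D \<subseteq> half_edges H \<and>
     (\<forall>x\<in>flags H. half_edge H x \<in> D \<longleftrightarrow> half_edge H (eseg H x) \<notin> D)"

text \<open>
  One step around a vertex: the half-edges at \<open>x\<close> and at \<open>rot x\<close> are the two that bound the corner
  \<open>{x, vseg x}\<close>.
\<close>

definition rot :: "('f, 'v) ribbon_graph \<Rightarrow> 'f \<Rightarrow> 'f" where
  "rot H x = cseg H (vseg H x)"

text \<open>The cyclic pattern in, in, out, out whose incoming half-edges bound the corner \<open>{x, vseg x}\<close>.\<close>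

definition in_in_out_out :: "('f, 'v) ribbon_graph \<Rightarrow> 'f set set \<Rightarrow> 'f \<Rightarrow> bool" where
  "in_in_out_out H D x \<longleftrightarrow>
     half_edge H x \<notin> D \<and> half_edge H (rot H x) \<notin> D \<and>
     half_edge H (rot H (rot H x)) \<in> D \<and> half_edge H (rot H (rot H (rot H x))) \<in> D"

definition all_in_or_all_out :: "('f, 'v) ribbon_graph \<Rightarrow> 'f set set \<Rightarrow> 'f set + 'v \<Rightarrow> bool" where
  "all_in_or_all_out H D w \<longleftrightarrow>
     (\<forall>x\<in>vertex_flags w. half_edge H x \<notin> D) \<or> (\<forall>x\<in>vertex_flags w. half_edge H x \<in> D)"

definition crossing_total_direction ::
  "('f, 'v) ribbon_graph \<Rightarrow> ('f \<times> colour) set set \<Rightarrow> bool" where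
  "crossing_total_direction G D \<longleftrightarrow>
     direction (medial_graph G) D \<and>
     (\<forall>w\<in>verts (medial_graph G).
        (\<exists>x\<in>vertex_flags w. in_in_out_out (medial_graph G) D x) \<or>
        all_in_or_all_out (medial_graph G) D w)"

definition c_vertex ::
  "('f, 'v) ribbon_graph \<Rightarrow> ('f \<times> colour) set set \<Rightarrow> ('f \<times> colour) set + 'v \<Rightarrow> bool" where
  "c_vertex G D w \<longleftrightarrow>
     (\<exists>x\<in>vertex_flags w. in_in_out_out (medial_graph G) D x \<and> (\<exists>F\<in>black_faces G. x \<in> F))"

definition d_vertex ::
  "('f, 'v) ribbon_graph \<Rightarrow> ('f \<times> colour) set set \<Rightarrow> ('f \<times> colour) set + 'v \<Rightarrow> bool" where
  "d_vertex G D w \<longleftrightarrow>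
     (\<exists>x\<in>vertex_flags w. in_in_out_out (medial_graph G) D x \<and> (\<exists>F\<in>white_faces G. x \<in> F))"

definition t_vertex ::
  "('f, 'v) ribbon_graph \<Rightarrow> ('f \<times> colour) set set \<Rightarrow> ('f \<times> colour) set + 'v \<Rightarrow> bool" where
  "t_vertex G D w \<longleftrightarrow> all_in_or_all_out (medial_graph G) D w"

definition c_edges :: "('f, 'v) ribbon_graph \<Rightarrow> ('f \<times> colour) set set \<Rightarrow> 'f set set" where
  "c_edges G D = {e \<in> edges G. c_vertex G D (medial_vertex e)}"

definition d_edges :: "('f, 'v) ribbon_graph \<Rightarrow> ('f \<times> colour) set set \<Rightarrow> 'f set set" where
  "d_edges G D = {e \<in> edges G. d_vertex G D (medial_vertex e)}"

definition t_edges :: "('f, 'v) ribbon_graph \<Rightarrow> ('f \<times> colour) set set \<Rightarrow> 'f set set" where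
  "t_edges G D = {e \<in> edges G. t_vertex G D (medial_vertex e)}"


lemma ribbon_graphD:
  assumes "is_ribbon_graph G" "x \<in> flags G"
  shows "cseg G x \<in> flags G" "cseg G x \<noteq> x" "cseg G (cseg G x) = x"
    "eseg G x \<in> flags G" "eseg G x \<noteq> x" "eseg G (eseg G x) = x"
    "vseg G x \<in> flags G" "vseg G x \<noteq> x" "vseg G (vseg G x) = x"
    "cseg G (eseg G x) = eseg G (cseg G x)" "cseg G x \<noteq> eseg G x" "eseg G (cseg G x) \<noteq> x"
  using assms unfolding is_ribbon_graph_def pairing_on_def by (blast, blast, blast, blast, blast,
    blast, blast, blast, blast, blast, blast, metis)

lemma four_flags:
  assumes "is_ribbon_graph G" "x \<in> flags G"
  shows "cseg G x \<in> flags G" "eseg G x \<in> flags G" "eseg G (cseg G x) \<in> flags G"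
    "cseg G (cseg G x) = x" "eseg G (eseg G x) = x" "cseg G (eseg G x) = eseg G (cseg G x)"
    "eseg G (eseg G (cseg G x)) = cseg G x" "cseg G (eseg G (cseg G x)) = eseg G x"
    "x \<noteq> cseg G x" "x \<noteq> eseg G x" "x \<noteq> eseg G (cseg G x)" "cseg G x \<noteq> eseg G x"
    "cseg G x \<noteq> eseg G (cseg G x)" "eseg G x \<noteq> eseg G (cseg G x)"
proof -
  note R = ribbon_graphD[OF assms(1)]
  have c: "cseg G x \<in> flags G" and e: "eseg G x \<in> flags G" using R assms(2) by blast+
  note f = R[OF assms(2)] R[OF c] R[OF e]
  show "cseg G x \<in> flags G" "eseg G x \<in> flags G" "eseg G (cseg G x) \<in> flags G"
    "cseg G (cseg G x) = x" "eseg G (eseg G x) = x" "cseg G (eseg G x) = eseg G (cseg G x)"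
    "eseg G (eseg G (cseg G x)) = cseg G x" "cseg G (eseg G (cseg G x)) = eseg G x"
    "x \<noteq> cseg G x" "x \<noteq> eseg G x" "x \<noteq> eseg G (cseg G x)" "cseg G x \<noteq> eseg G x"
    "cseg G x \<noteq> eseg G (cseg G x)" "eseg G x \<noteq> eseg G (cseg G x)"
    using f by auto
qed

lemma edge_of_cong:
  assumes "is_ribbon_graph G" "x \<in> flags G" "y \<in> edge_of G x"
  shows "y \<in> flags G" "edge_of G y = edge_of G x"
proof -
  note f = four_flags[OF assms(1,2)]
  have y: "y = x \<or> y = cseg G x \<or> y = eseg G x \<or> y = eseg G (cseg G x)"
    using assms(3) by (simp add: edge_of_def)
  then show "y \<in> flags G" using f assms(2) by auto
  show "edge_of G y = edge_of G x"
    using y by (elim disjE) (auto simp: edge_of_def f)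
qed

lemma edge_of_seg:
  assumes "is_ribbon_graph G" "x \<in> flags G"
  shows "edge_of G (cseg G x) = edge_of G x" "edge_of G (eseg G x) = edge_of G x"
proof -
  have "cseg G x \<in> edge_of G x" "eseg G x \<in> edge_of G x" by (simp_all add: edge_of_def)
  then show "edge_of G (cseg G x) = edge_of G x" "edge_of G (eseg G x) = edge_of G x"
    using edge_of_cong(2)[OF assms] by blast+
qed

lemma edge_orientation_exists:
  assumes G: "is_ribbon_graph G"
  shows "\<exists>T. edge_orientation G T"
proof -
  note R = ribbon_graphD[OF G]
  define r where "r e = (SOME y. y \<in> e)" for e :: "'a set"
  define T where "T = {x \<in> flags G. x = r (edge_of G x) \<or> x = eseg G (cseg G (r (edge_of G x)))}"
  have "(cseg G x \<in> T \<longleftrightarrow> x \<notin> T) \<and> (eseg G x \<in> T \<longleftrightarrow> x \<notin> T)" if x: "x \<in> flags G" for x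
  proof -
    have "x \<in> edge_of G x" by (simp add: edge_of_def)
    then have "r (edge_of G x) \<in> edge_of G x" unfolding r_def by (rule someI)
    then consider "r (edge_of G x) = x" | "r (edge_of G x) = cseg G x"
      | "r (edge_of G x) = eseg G x" | "r (edge_of G x) = eseg G (cseg G x)"
      by (auto simp: edge_of_def)
    moreover have "edge_of G (cseg G x) = edge_of G x" "edge_of G (eseg G x) = edge_of G x"
      by (rule edge_of_seg[OF G x])+
    moreover have "cseg G x \<in> flags G" "eseg G x \<in> flags G" "cseg G (cseg G x) = x"
      "eseg G (eseg G x) = x" "cseg G (eseg G x) = eseg G (cseg G x)"
      "eseg G (eseg G (cseg G x)) = cseg G x" "cseg G (eseg G (cseg G x)) = eseg G x"
      "x \<noteq> cseg G x" "x \<noteq> eseg G x" "x \<noteq> eseg G (cseg G x)" "cseg G x \<noteq> eseg G x"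
      "cseg G x \<noteq> eseg G (cseg G x)" "eseg G x \<noteq> eseg G (cseg G x)"
      using four_flags[OF G x] by simp_all
    ultimately show ?thesis
      unfolding T_def using x by cases auto
  qed
  moreover have "T \<subseteq> flags G" by (simp add: T_def)
  ultimately have "edge_orientation G T" by (simp add: edge_orientation_def)
  then show ?thesis ..
qed

text \<open>
  The partial dual does not depend on the chosen orientation: it exchanges the roles of common and
  edge line segments on the edges in \<open>A\<close>.
\<close>

lemma partial_dual_simps [simp]:
  "flags (partial_dual G T A) = flags G"
  "cseg (partial_dual G T A) = (\<lambda>x. if edge_of G x \<in> A then eseg G x else cseg G x)"
  "vseg (partial_dual G T A) = vseg G"
  "bare (partial_dual G T A) = bare G"
  by (simp_all add: partial_dual_def ribbon_of_arrows_def dual_arrows_def)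

lemma eseg_partial_dual:
  assumes G: "is_ribbon_graph G" and T: "edge_orientation G T" and x: "x \<in> flags G"
  shows "eseg (partial_dual G T A) x = (if edge_of G x \<in> A then cseg G x else eseg G x)"
proof -
  note f = four_flags[OF G x]
  note E = edge_of_seg[OF G x]
  have E': "edge_of G (eseg G (cseg G x)) = edge_of G x"
    using edge_of_seg(2)[OF G f(1)] E(1) by simp
  have T': "cseg G x \<in> T \<longleftrightarrow> x \<notin> T" "eseg G x \<in> T \<longleftrightarrow> x \<notin> T" "eseg G (cseg G x) \<in> T \<longleftrightarrow> x \<in> T"
    using T x f(1) unfolding edge_orientation_def by blast+
  have mem: "q = x \<or> q = cseg G x \<or> q = eseg G x \<or> q = eseg G (cseg G x)"
    if "edge_of G q = edge_of G x" for q
  proof -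
    have "q \<in> edge_of G q" by (simp add: edge_of_def)
    with that show ?thesis by (simp add: edge_of_def)
  qed
  show ?thesis
    unfolding partial_dual_def ribbon_of_arrows_def dual_arrows_def
    by (auto simp: x E E' T' f f(9-14)[symmetric] intro!: the_equality dest!: mem)
qed

lemma is_ribbon_graph_partial_dual:
  assumes G: "is_ribbon_graph G" and T: "edge_orientation G T"
  shows "is_ribbon_graph (partial_dual G T A)"
proof -
  note R = ribbon_graphD[OF G]
  note E = edge_of_seg[OF G]
  have F: "finite (flags G)" "finite (bare G)" using G by (simp_all add: is_ribbon_graph_def)
  show ?thesis
    unfolding is_ribbon_graph_def pairing_on_def
    by (auto simp: F R E R(11)[THEN not_sym] eseg_partial_dual[OF G T])
qed

lemma flip_simps [simp]: "flip a \<noteq> a" "flip (flip a) = a"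
  by (cases a; simp)+

lemma is_ribbon_graph_medial:
  assumes G: "is_ribbon_graph G"
  shows "is_ribbon_graph (medial_graph G)"
proof -
  note R = ribbon_graphD[OF G]
  have "finite (UNIV :: colour set)"
    by (rule finite_subset[of _ "{Black, White}"]) (auto intro: colour.exhaust)
  then show ?thesis
    using G unfolding is_ribbon_graph_def pairing_on_def medial_graph_def
    by (auto split: colour.split)
qed

lemma circle_refl: "x \<in> circle f g x"
  by (simp add: circle_def)

lemma circle_step:
  assumes "y \<in> circle f g x"
  shows "f y \<in> circle f g x" "g y \<in> circle f g x"
  using assms unfolding circle_def by (auto intro: rtranclp.rtrancl_into_rtrancl)

lemma circle_induct [consumes 1, case_names refl left right]:
  assumes "y \<in> circle f g x" "P x"
    "\<And>y. y \<in> circle f g x \<Longrightarrow> P y \<Longrightarrow> P (f y)" "\<And>y. y \<in> circle f g x \<Longrightarrow> P y \<Longrightarrow> P (g y)"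
  shows "P y"
proof -
  have "(\<lambda>u w. w = f u \<or> w = g u)\<^sup>*\<^sup>* x y" using assms(1) by (simp add: circle_def)
  then show ?thesis
    by (induction rule: rtranclp_induct) (use assms in \<open>auto simp: circle_def\<close>)
qed

lemma verts_medial:
  assumes G: "is_ribbon_graph G"
  shows "verts (medial_graph G) = medial_vertex ` edges G"
proof -
  note R = ribbon_graphD[OF G]
  let ?M = "medial_graph G"
  have "circle (cseg ?M) (vseg ?M) (x, a) = edge_of G x \<times> UNIV" if x: "x \<in> flags G" for x a
  proof (intro equalityI subsetI)
    fix p assume "p \<in> circle (cseg ?M) (vseg ?M) (x, a)"
    then show "p \<in> edge_of G x \<times> UNIV"
    proof (induction rule: circle_induct)
      case refl then show ?case by (simp add: edge_of_def)
    next
      case (left p) then show ?case by (auto simp: medial_graph_def)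
    next
      case (right p)
      then show ?case
        by (cases p; cases "snd p") (auto simp: medial_graph_def edge_of_def R x)
    qed
  next
    let ?C = "circle (cseg ?M) (vseg ?M) (x, a)"
    fix p assume p: "p \<in> edge_of G x \<times> (UNIV :: colour set)"
    have fl: "(y, b) \<in> ?C" if "(y, c) \<in> ?C" for y b c
      using that circle_step(1)[OF that] by (cases b; cases c) (auto simp: medial_graph_def)
    have st: "(cseg G y, b) \<in> ?C \<and> (eseg G y, b) \<in> ?C" if "(y, c) \<in> ?C" for y b c
    proof -
      have "vseg ?M (y, Black) \<in> ?C" "vseg ?M (y, White) \<in> ?C"
        by (intro circle_step(2) fl[OF that])+
      moreover have "vseg ?M (y, Black) = (cseg G y, Black)" "vseg ?M (y, White) = (eseg G y, White)"
        by (simp_all add: medial_graph_def)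
      ultimately show ?thesis by (metis fl)
    qed
    have "(x, a) \<in> ?C" by (rule circle_refl)
    then show "p \<in> ?C" using p st fl by (cases p) (simp add: edge_of_def, metis)
  qed
  then show ?thesis
    unfolding verts_def edges_def medial_vertex_def
    by (force simp: medial_graph_def image_iff)
qed

text \<open>Every flag of the medial graph lies on the face of its colour.\<close>

lemma circle_medial:
  "circle (eseg (medial_graph G)) (vseg (medial_graph G)) (x, Black) =
     circle (cseg G) (vseg G) x \<times> {Black}"
  "circle (eseg (medial_graph G)) (vseg (medial_graph G)) (x, White) =
     circle (eseg G) (vseg G) x \<times> {White}"
proof -
  let ?M = "medial_graph G"
  have e: "eseg ?M (y, a) = (vseg G y, a)"
    and b: "vseg ?M (y, Black) = (cseg G y, Black)" and w: "vseg ?M (y, White) = (eseg G y, White)"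
    for y a by (simp_all add: medial_graph_def)
  have "circle (eseg ?M) (vseg ?M) (x, a) = circle f (vseg G) x \<times> {a}"
    if v: "\<And>y. vseg ?M (y, a) = (f y, a)" for f a
  proof (intro equalityI subsetI)
    fix p assume "p \<in> circle (eseg ?M) (vseg ?M) (x, a)"
    then show "p \<in> circle f (vseg G) x \<times> {a}"
      by (induction rule: circle_induct) (auto simp: e v circle_refl intro: circle_step)
  next
    fix p assume "p \<in> circle f (vseg G) x \<times> {a}"
    then obtain y where p: "p = (y, a)" and y: "y \<in> circle f (vseg G) x" by blast
    from y have "(y, a) \<in> circle (eseg ?M) (vseg ?M) (x, a)"
    proof (induction rule: circle_induct)
      case refl show ?case by (rule circle_refl)
    next
      case (left y) from circle_step(2)[OF left(2)] show ?case by (simp only: v)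
    next
      case (right y) from circle_step(1)[OF right(2)] show ?case by (simp only: e)
    qed
    with p show "p \<in> circle (eseg ?M) (vseg ?M) (x, a)" by simp
  qed
  with b w show
    "circle (eseg ?M) (vseg ?M) (x, Black) = circle (cseg G) (vseg G) x \<times> {Black}"
    "circle (eseg ?M) (vseg ?M) (x, White) = circle (eseg G) (vseg G) x \<times> {White}"
    by blast+
qed

lemma checkerboard:
  assumes "x \<in> flags G"
  shows "(\<exists>F\<in>black_faces G. (x, a) \<in> F) \<longleftrightarrow> a = Black"
    and "(\<exists>F\<in>white_faces G. (x, a) \<in> F) \<longleftrightarrow> a = White"
proof -
  let ?M = "medial_graph G"
  have fM: "(x, b) \<in> flags ?M" for b using assms by (simp add: medial_graph_def)
  have face: "circle (eseg ?M) (vseg ?M) (x, b) \<in> faces ?M" for b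
    unfolding faces_def using fM by blast
  have refl: "(x, b) \<in> circle (eseg ?M) (vseg ?M) (x, b)" for b by (rule circle_refl)
  have "Inl (circle (cseg G) (vseg G) x) \<in> verts G" using assms by (simp add: verts_def)
  then have "\<exists>v\<in>verts G. circle (eseg ?M) (vseg ?M) (x, Black) = vertex_flags v \<times> {Black}"
    by (rule bexI[rotated]) (simp add: circle_medial vertex_flags_def)
  with face have black: "circle (eseg ?M) (vseg ?M) (x, Black) \<in> black_faces G"
    by (simp add: black_faces_def)
  have sub: "F \<subseteq> UNIV \<times> {Black}" if "F \<in> black_faces G" for F
    using that by (auto simp: black_faces_def)
  show "(\<exists>F\<in>black_faces G. (x, a) \<in> F) \<longleftrightarrow> a = Black"
    using black sub refl[of Black] by blast
  have white: "circle (eseg ?M) (vseg ?M) (x, White) \<in> white_faces G"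
    using face sub refl[of White] unfolding white_faces_def by blast
  have "F \<in> black_faces G" if F: "F \<in> faces ?M" "(x, Black) \<in> F" for F
  proof -
    from F(1) obtain y b where y: "y \<in> flags G" and Fy: "F = circle (eseg ?M) (vseg ?M) (y, b)"
      by (auto simp: faces_def medial_graph_def)
    with F(2) have b: "b = Black" by (cases b) (auto simp: circle_medial)
    have "Inl (circle (cseg G) (vseg G) y) \<in> verts G" using y by (simp add: verts_def)
    then have "\<exists>v\<in>verts G. F = vertex_flags v \<times> {Black}"
      by (rule bexI[rotated]) (simp add: Fy b circle_medial vertex_flags_def)
    with F(1) show ?thesis by (simp add: black_faces_def)
  qed
  then show "(\<exists>F\<in>white_faces G. (x, a) \<in> F) \<longleftrightarrow> a = White"
    using white refl[of White] unfolding white_faces_def by (cases a) auto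
qed

end

theory Submission
  imports Defs "HOL-Combinatorics.Orbits"
begin

text \<open>
  Record a direction of \<open>G\<^sub>m\<close> by the set \<open>Q\<close> of flags whose half-edge leaves its vertex; exactly
  one of the two half-edges at a corner leaves, so \<open>vseg\<close> complements \<open>Q\<close>.  The \<open>c\<close>-edges are
  those on which \<open>Q\<close> is constant along common line segments only, the \<open>d\<close>-edges those on which it
  is constant along edge line segments only, and the \<open>t\<close>-edges those on which it is constant.  Let
  \<open>p\<close> exchange the ends of the common line segments of the partial dual.  Then the crossing-total
  directions compatible with \<open>A\<close> are exactly the sets \<open>Q\<close> that are preserved by \<open>p\<close> and
  complemented by \<open>vseg\<close>.

  Walking around a vertex of the partial dual, such a \<open>Q\<close> alternates from one half-edge to the
  next.  An orbit of \<open>vseg \<circ> p\<close> contains exactly one end of each half-edge at the vertex, and a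
  cycle has an alternating subset if and only if its length is even.
\<close>

section \<open>Sets alternating along the closed curves of two pairings\<close>

definition preserves_on :: "'a set \<Rightarrow> ('a \<Rightarrow> 'a) \<Rightarrow> 'a set \<Rightarrow> bool" where
  "preserves_on X f Q \<longleftrightarrow> (\<forall>x\<in>X. f x \<in> Q \<longleftrightarrow> x \<in> Q)"

definition complements_on :: "'a set \<Rightarrow> ('a \<Rightarrow> 'a) \<Rightarrow> 'a set \<Rightarrow> bool" where
  "complements_on X f Q \<longleftrightarrow> (\<forall>x\<in>X. f x \<in> Q \<longleftrightarrow> x \<notin> Q)"

definition alternates_on :: "'a set \<Rightarrow> ('a \<Rightarrow> 'a) \<Rightarrow> ('a \<Rightarrow> 'a) \<Rightarrow> 'a set \<Rightarrow> bool" where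
  "alternates_on X p v Q \<longleftrightarrow> preserves_on X p Q \<and> complements_on X v Q"

lemmas alternating_defs = preserves_on_def complements_on_def alternates_on_def

definition pairs_on :: "'a set \<Rightarrow> ('a \<Rightarrow> 'a) \<Rightarrow> 'a set set" where
  "pairs_on X p = (\<lambda>x. {x, p x}) ` X"

lemma alternates_on_subset:
  assumes "alternates_on X p v Q" "Y \<subseteq> X"
  shows "alternates_on Y p v Q"
  using assms by (auto simp: alternating_defs)

lemma even_card_of_complements_on:
  assumes fin: "finite X" and inj: "inj_on f X" and closed: "f ` X \<subseteq> X"
    and Q: "complements_on X f Q"
  shows "even (card X)"
proof -
  have "card (X \<inter> Q) \<le> card (X - Q)" "card (X - Q) \<le> card (X \<inter> Q)"
    by (rule card_inj_on_le[of f];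
        use fin closed Q in \<open>auto simp: complements_on_def intro: inj_on_subset[OF inj]\<close>)+
  then have "card (X \<inter> Q) = card (X - Q)" by (rule antisym)
  with card_Int_Diff[OF fin, of Q] show ?thesis by simp
qed

lemma self_in_orbit_of_inj_on:
  assumes fin: "finite X" and inj: "inj_on f X" and closed: "f ` X \<subseteq> X" and x: "x \<in> X"
  shows "x \<in> orbit f x"
proof (rule ccontr)
  assume notin: "x \<notin> orbit f x"
  have sub: "orbit f x \<subseteq> X"
  proof
    fix y assume "y \<in> orbit f x"
    then show "y \<in> X" by induction (use closed x in auto)
  qed
  then have "finite (orbit f x)" using fin by (rule finite_subset)
  moreover have "inj_on f (insert x (orbit f x))"
    using inj by (rule inj_on_subset) (use sub x in blast)
  moreover have "f ` insert x (orbit f x) \<subseteq> orbit f x" by (auto intro: orbit.intros)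
  ultimately have "card (insert x (orbit f x)) \<le> card (orbit f x)" by (intro card_inj_on_le)
  with notin \<open>finite (orbit f x)\<close> show False by simp
qed

lemma cyclic_on_image_eq:
  assumes "cyclic_on f S"
  shows "f ` S = S"
proof
  show "f ` S \<subseteq> S" using cyclic_on_inI[OF assms] by blast
  obtain x where "x \<in> S" "S = orbit f x" using assms by (auto simp: cyclic_on_def)
  then show "S \<subseteq> f ` S" by (auto elim: orbit.cases)
qed

lemma ex_complements_on_cyclic_iff:
  assumes cyc: "cyclic_on f S"
  shows "(\<exists>Q. complements_on S f Q) \<longleftrightarrow> even (card S)"
proof
  have "inj_on f S"
    using finite_surj_inj[OF finite_cyclic_on[OF cyc]] cyclic_on_image_eq[OF cyc] by simp
  moreover assume "\<exists>Q. complements_on S f Q"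
  ultimately show "even (card S)"
    using even_card_of_complements_on[OF finite_cyclic_on[OF cyc]] cyclic_on_image_eq[OF cyc]
    by blast
next
  assume even: "even (card S)"
  obtain x where x: "x \<in> orbit f x" and S: "S = orbit f x"
    using cyc by (auto simp: cyclic_on_def)
  define n where "n = funpow_dist1 f x x"
  let ?pow = "\<lambda>i. (f ^^ i) x"
  have S_pow: "S = ?pow ` {0..<n}" and inj: "inj_on ?pow {0..<n}" and period: "?pow n = x"
    unfolding S n_def
    by (rule orbit_conv_funpow_dist1[OF x] inj_on_funpow_dist1[OF x] funpow_dist1_prop[OF x])+
  then have "even n" using even by (simp add: card_image)
  define Q where "Q = ?pow ` {i \<in> {0..<n}. even i}"
  have Q_pow: "?pow i \<in> Q \<longleftrightarrow> even i" if "i < n" for i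
    unfolding Q_def using that by (subst inj_on_image_mem_iff[OF inj]) auto
  have "f (?pow i) \<in> Q \<longleftrightarrow> ?pow i \<notin> Q" if i: "i < n" for i
  proof (cases "Suc i < n")
    case True
    then show ?thesis using Q_pow[of "Suc i"] Q_pow[OF i] by simp
  next
    case False
    then have "n = Suc i" using i by simp
    then have "f (?pow i) = ?pow 0" "odd i" using period \<open>even n\<close> by simp_all
    then show ?thesis using Q_pow[of 0] Q_pow[OF i] i by simp
  qed
  then have "complements_on S f Q" by (auto simp: complements_on_def S_pow)
  then show "\<exists>Q. complements_on S f Q" ..
qed

lemma pairing_onD:
  assumes "pairing_on X f" "x \<in> X"
  shows "f x \<in> X" "f x \<noteq> x" "f (f x) = x"
  using assms by (auto simp: pairing_on_def)

lemma circle_least: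
  assumes "x \<in> S" "f ` S \<subseteq> S" "g ` S \<subseteq> S"
  shows "circle f g x \<subseteq> S"
proof
  fix y assume "y \<in> circle f g x"
  then show "y \<in> S" by (induction rule: circle_induct) (use assms in auto)
qed

lemma orbit_comp_subset_circle: "orbit (v \<circ> p) x \<subseteq> circle p v x"
proof
  fix y assume "y \<in> orbit (v \<circ> p) x"
  then show "y \<in> circle p v x" by induction (auto intro: circle_refl circle_step)
qed

context
  fixes X :: "'a set" and p v :: "'a \<Rightarrow> 'a"
  assumes p: "pairing_on X p" and v: "pairing_on X v"
begin

private lemmas pD = pairing_onD[OF p] and vD = pairing_onD[OF v]

lemma circle_subset:
  assumes "x \<in> X"
  shows "circle p v x \<subseteq> X"
  by (rule circle_least) (use assms pD vD in auto)

lemma circle_step_eq: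
  assumes "x \<in> X"
  shows "circle p v (p x) = circle p v x" "circle p v (v x) = circle p v x"
proof -
  have trans: "circle p v y \<subseteq> circle p v z" if "y \<in> circle p v z" for y z
    using that by (auto simp: circle_def)
  have "p x \<in> circle p v x" "v x \<in> circle p v x"
    by (intro circle_step circle_refl)+
  moreover have "x \<in> circle p v (p x)" "x \<in> circle p v (v x)"
    using circle_step(1)[OF circle_refl, of p "p x"] circle_step(2)[OF circle_refl, of v "v x"]
      pD[OF assms] vD[OF assms] by simp_all
  ultimately show "circle p v (p x) = circle p v x" "circle p v (v x) = circle p v x"
    using trans by blast+
qed

lemma orbit_comp_in:
  assumes "x \<in> X" "y \<in> orbit (v \<circ> p) x"
  shows "y \<in> X"
  using subsetD[OF orbit_comp_subset_circle assms(2)] circle_subset[OF assms(1)]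
  by (rule rev_subsetD)

text \<open>
  Since \<open>p\<close> reverses the sense of rotation \<open>v \<circ> p\<close>, an equality \<open>p y = (v \<circ> p)\<^sup>m y\<close> would produce
  a fixed point of \<open>p\<close> or \<open>v\<close> half-way.
\<close>

lemma pairing_neq_funpow_comp:
  assumes "y \<in> X"
  shows "p y \<noteq> ((v \<circ> p) ^^ m) y"
  using assms
proof (induction m arbitrary: y rule: induct_nat_012)
  case 0 then show ?case using pD by simp
next
  case 1 then show ?case using vD(2)[OF pD(1)] by (simp add: eq_commute)
next
  case (ge2 m)
  let ?r = "v \<circ> p"
  have pow_in: "(?r ^^ i) y \<in> X" for i by (induction i) (use ge2.prems pD vD in auto)
  have pow: "(?r ^^ m) (?r y) = (?r ^^ Suc m) y" by (simp add: funpow_swap1)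
  show ?case
  proof
    assume "p y = (?r ^^ Suc (Suc m)) y"
    then have "?r y = v (v (p ((?r ^^ Suc m) y)))" by simp
    also have "\<dots> = p ((?r ^^ Suc m) y)" using vD(3)[OF pD(1)[OF pow_in]] .
    finally have "?r y = p ((?r ^^ Suc m) y)" .
    then have "p (?r y) = (?r ^^ m) (?r y)" using pD(3) pow_in pow by metis
    moreover have "?r y \<in> X" using pow_in[of 1] by simp
    ultimately show False using ge2.IH(1) by blast
  qed
qed

context
  assumes fin: "finite X"
begin

lemma self_in_orbit_comp:
  assumes "x \<in> X"
  shows "x \<in> orbit (v \<circ> p) x"
proof (rule self_in_orbit_of_inj_on[OF fin])
  show "inj_on (v \<circ> p) X" by (rule inj_on_inverseI[of _ "p \<circ> v"]) (simp add: pD vD)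
qed (use assms pD vD in auto)

lemma cyclic_on_orbit_comp:
  assumes "x \<in> X"
  shows "cyclic_on (v \<circ> p) (orbit (v \<circ> p) x)"
  using self_in_orbit_comp[OF assms] by (rule cyclic_on_singleI) simp

lemma orbit_comp_disjoint_image:
  assumes x: "x \<in> X"
  shows "orbit (v \<circ> p) x \<inter> p ` orbit (v \<circ> p) x = {}"
proof -
  have "p y \<notin> orbit (v \<circ> p) x" if y: "y \<in> orbit (v \<circ> p) x" for y
  proof -
    have "y \<in> X" using x y by (rule orbit_comp_in)
    moreover have "orbit (v \<circ> p) x = orbit (v \<circ> p) y"
      using orbit_cyclic_eq3[OF cyclic_on_orbit_comp[OF x] y] by simp
    ultimately show ?thesis using pairing_neq_funpow_comp by (auto simp: orbit_altdef)
  qed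
  then show ?thesis by blast
qed

lemma circle_eq_orbit_comp:
  assumes x: "x \<in> X"
  shows "circle p v x = orbit (v \<circ> p) x \<union> p ` orbit (v \<circ> p) x" (is "_ = ?R \<union> p ` ?R")
proof
  note in_X = orbit_comp_in[OF x]
  have p_p: "p ` p ` ?R = ?R" unfolding image_image using pD(3)[OF in_X] by simp
  have v_p: "v ` p ` ?R = ?R"
    using cyclic_on_image_eq[OF cyclic_on_orbit_comp[OF x]] by (simp only: image_comp)
  have "v ` v ` p ` ?R = p ` ?R"
    unfolding image_image using vD(3)[OF pD(1)[OF in_X]] by simp
  then have v: "v ` ?R = p ` ?R" by (simp only: v_p)
  show "circle p v x \<subseteq> ?R \<union> p ` ?R"
  proof (rule circle_least)
    show "x \<in> ?R \<union> p ` ?R" using self_in_orbit_comp[OF x] by blast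
  qed (simp_all only: image_Un p_p v_p v, blast+)
  show "?R \<union> p ` ?R \<subseteq> circle p v x"
    using orbit_comp_subset_circle[of v p x] by (auto intro: circle_step)
qed

lemma card_pairs_on_circle:
  assumes x: "x \<in> X"
  shows "card (pairs_on (circle p v x) p) = card (orbit (v \<circ> p) x)" (is "_ = card ?R")
proof -
  have "{p y, p (p y)} = {y, p y}" if "y \<in> ?R" for y
    using pD(3)[OF orbit_comp_in[OF x that]] by (simp add: insert_commute)
  then have "pairs_on (circle p v x) p = pairs_on ?R p"
    unfolding circle_eq_orbit_comp[OF x] by (auto simp: pairs_on_def image_Un image_image)
  moreover have "inj_on (\<lambda>y. {y, p y}) ?R"
    using orbit_comp_disjoint_image[OF x] by (auto simp: inj_on_def doubleton_eq_iff)
  ultimately show ?thesis by (simp add: pairs_on_def card_image)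
qed

lemma ex_alternates_on_circle:
  assumes x: "x \<in> X" and Q: "complements_on (orbit (v \<circ> p) x) (v \<circ> p) Q"
  shows "\<exists>Q'. alternates_on (circle p v x) p v Q'"
proof -
  let ?R = "orbit (v \<circ> p) x"
  note cyclic = cyclic_on_orbit_comp[OF x] and disjoint = orbit_comp_disjoint_image[OF x]
    and in_X = orbit_comp_in[OF x]
  define Q' where "Q' = (Q \<inter> ?R) \<union> p ` (Q \<inter> ?R)"
  have inj: "inj_on p ?R" using pD(3)[OF in_X] by (rule inj_on_inverseI)
  have mem_Q': "y \<in> Q' \<longleftrightarrow> y \<in> Q" "p y \<in> Q' \<longleftrightarrow> y \<in> Q" if y: "y \<in> ?R" for y
  proof -
    show "y \<in> Q' \<longleftrightarrow> y \<in> Q" using y disjoint unfolding Q'_def by blast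
    have "p y \<notin> ?R" using y disjoint by blast
    then show "p y \<in> Q' \<longleftrightarrow> y \<in> Q"
      using inj_on_image_mem_iff[OF inj y, of "Q \<inter> ?R"] y unfolding Q'_def by blast
  qed
  have "v (p y) \<in> Q' \<longleftrightarrow> y \<notin> Q" if "y \<in> ?R" for y
    using that Q mem_Q'(1)[OF cyclic_on_inI[OF cyclic]] by (simp add: complements_on_def)
  moreover have "v y \<in> Q' \<longleftrightarrow> y \<notin> Q" if "y \<in> ?R" for y
  proof -
    have "y \<in> (v \<circ> p) ` ?R" using that unfolding cyclic_on_image_eq[OF cyclic] .
    then obtain z where z: "z \<in> ?R" "y = (v \<circ> p) z" by blast
    then have "v y = p z" using vD(3)[OF pD(1)[OF in_X]] by simp
    then show ?thesis using z Q mem_Q'(2)[OF z(1)] by (simp add: complements_on_def)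
  qed
  ultimately have "alternates_on (circle p v x) p v Q'"
    unfolding alternating_defs circle_eq_orbit_comp[OF x] ball_Un ball_simps
    using mem_Q' pD(3)[OF in_X] by simp
  then show ?thesis ..
qed

lemma ex_alternates_on_circle_iff:
  assumes x: "x \<in> X"
  shows "(\<exists>Q. alternates_on (circle p v x) p v Q) \<longleftrightarrow>
    even (card (pairs_on (circle p v x) p))"
proof -
  let ?R = "orbit (v \<circ> p) x"
  have "complements_on ?R (v \<circ> p) Q" if "alternates_on (circle p v x) p v Q" for Q
    using that unfolding circle_eq_orbit_comp[OF x] by (auto simp: alternating_defs)
  then have "(\<exists>Q. alternates_on (circle p v x) p v Q) \<longleftrightarrow> (\<exists>Q. complements_on ?R (v \<circ> p) Q)"
    using ex_alternates_on_circle[OF x] by blast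
  then show ?thesis
    by (simp only: ex_complements_on_cyclic_iff[OF cyclic_on_orbit_comp[OF x]]
        card_pairs_on_circle[OF x])
qed

lemma ex_alternates_on_iff:
  "(\<exists>Q. alternates_on X p v Q) \<longleftrightarrow>
    (\<forall>x\<in>X. even (card (pairs_on (circle p v x) p)))"
proof -
  have "(\<exists>Q. alternates_on X p v Q) \<longleftrightarrow> (\<forall>x\<in>X. \<exists>Q. alternates_on (circle p v x) p v Q)"
  proof
    assume "\<exists>Q. alternates_on X p v Q"
    then show "\<forall>x\<in>X. \<exists>Q. alternates_on (circle p v x) p v Q"
      using alternates_on_subset circle_subset by metis
  next
    assume ex: "\<forall>x\<in>X. \<exists>Q. alternates_on (circle p v x) p v Q"
    define q where "q C = (SOME Q. alternates_on C p v Q)" for C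
    have q: "alternates_on (circle p v x) p v (q (circle p v x))" if "x \<in> X" for x
      unfolding q_def using bspec[OF ex that] by (rule someI_ex)
    have "(p x \<in> q (circle p v x) \<longleftrightarrow> x \<in> q (circle p v x)) \<and>
        (v x \<in> q (circle p v x) \<longleftrightarrow> x \<notin> q (circle p v x))" if "x \<in> X" for x
      using q[OF that] circle_refl[of x p v] unfolding alternating_defs by simp
    then have "alternates_on X p v {x. x \<in> q (circle p v x)}"
      unfolding alternating_defs by (simp add: circle_step_eq)
    then show "\<exists>Q. alternates_on X p v Q" ..
  qed
  then show ?thesis by (simp add: ex_alternates_on_circle_iff)
qed

end

end

section \<open>Eulerian ribbon graphs\<close>

lemma degree_Inr: "degree H (Inr b) = 0"
  by (auto simp: degree_def vertex_flags_def half_edges_def half_edge_def)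

lemma degree_Inl_circle:
  assumes H: "is_ribbon_graph H" and x: "x \<in> flags H"
  shows "degree H (Inl (circle (cseg H) (vseg H) x)) =
    card (pairs_on (circle (cseg H) (vseg H) x) (cseg H))"
proof -
  have "circle (cseg H) (vseg H) x \<subseteq> flags H"
    using H x by (intro circle_subset) (simp_all add: is_ribbon_graph_def)
  then have "{h \<in> half_edges H. h \<subseteq> circle (cseg H) (vseg H) x} =
      pairs_on (circle (cseg H) (vseg H) x) (cseg H)"
    by (auto simp: half_edges_def half_edge_def pairs_on_def intro: circle_step)
  then show ?thesis by (simp add: degree_def vertex_flags_def)
qed

lemma eulerian_iff_ex_alternates_on:
  assumes H: "is_ribbon_graph H"
  shows "eulerian H \<longleftrightarrow> (\<exists>Q. alternates_on (flags H) (cseg H) (vseg H) Q)"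
proof -
  have "eulerian H \<longleftrightarrow>
      (\<forall>x\<in>flags H. even (card (pairs_on (circle (cseg H) (vseg H) x) (cseg H))))"
    by (simp add: eulerian_def verts_def ball_Un degree_Inr degree_Inl_circle[OF H])
  also have "\<dots> \<longleftrightarrow> (\<exists>Q. alternates_on (flags H) (cseg H) (vseg H) Q)"
    using H by (subst ex_alternates_on_iff) (simp_all add: is_ribbon_graph_def)
  finally show ?thesis .
qed

section \<open>Directions of the medial graph\<close>

definition out_flags :: "('f \<times> colour) set set \<Rightarrow> 'f set" where
  "out_flags D = {x. {x} \<times> UNIV \<in> D}"

lemma half_edge_medial: "half_edge (medial_graph G) (x, a) = {x} \<times> UNIV"
proof -
  have "UNIV = {a, flip a}" by (cases a) (auto intro: colour.exhaust)
  then show ?thesis by (auto simp: half_edge_def medial_graph_def)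
qed

lemma direction_medial_iff:
  "direction (medial_graph G) D \<longleftrightarrow> D \<subseteq> (\<lambda>x. {x} \<times> UNIV) ` flags G \<and>
     complements_on (flags G) (vseg G) (out_flags D)"
proof -
  have flags: "flags (medial_graph G) = flags G \<times> UNIV" by (simp add: medial_graph_def)
  have "half_edges (medial_graph G) = (\<lambda>x. {x} \<times> UNIV) ` flags G"
    unfolding half_edges_def flags by (auto simp: half_edge_medial image_iff)
  moreover have "eseg (medial_graph G) (x, a) = (vseg G x, a)" for x a
    by (simp add: medial_graph_def)
  ultimately show ?thesis
    by (auto simp: flags direction_def half_edge_medial out_flags_def complements_on_def)
qed

lemma ex_direction_preserving_iff:
  assumes G: "is_ribbon_graph G" and p: "pairing_on (flags G) p"
  shows "(\<exists>D. direction (medial_graph G) D \<and> preserves_on (flags G) p (out_flags D)) \<longleftrightarrow>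
    (\<exists>Q. alternates_on (flags G) p (vseg G) Q)"
proof
  assume "\<exists>D. direction (medial_graph G) D \<and> preserves_on (flags G) p (out_flags D)"
  then show "\<exists>Q. alternates_on (flags G) p (vseg G) Q"
    unfolding direction_medial_iff alternates_on_def by blast
next
  assume "\<exists>Q. alternates_on (flags G) p (vseg G) Q"
  then obtain Q where Q: "alternates_on (flags G) p (vseg G) Q" ..
  define D :: "('a \<times> colour) set set" where "D = (\<lambda>x. {x} \<times> UNIV) ` (Q \<inter> flags G)"
  have "out_flags D = Q \<inter> flags G" by (auto simp: out_flags_def D_def times_eq_iff)
  then have "direction (medial_graph G) D" "preserves_on (flags G) p (out_flags D)"
    using Q ribbon_graphD(7)[OF G] pairing_onD(1)[OF p]
    by (auto simp: direction_medial_iff alternating_defs D_def)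
  then show "\<exists>D. direction (medial_graph G) D \<and> preserves_on (flags G) p (out_flags D)" by blast
qed

lemma in_in_out_out_medial_iff:
  assumes G: "is_ribbon_graph G" and x: "x \<in> flags G"
  shows "in_in_out_out (medial_graph G) D (x, Black) \<longleftrightarrow>
      x \<notin> out_flags D \<and> alternates_on (edge_of G x) (cseg G) (eseg G) (out_flags D)"
      (is ?black)
    and "in_in_out_out (medial_graph G) D (x, White) \<longleftrightarrow>
      x \<notin> out_flags D \<and> alternates_on (edge_of G x) (eseg G) (cseg G) (out_flags D)"
      (is ?white)
proof -
  have rot: "rot (medial_graph G) (y, Black) = (cseg G y, White)"
    "rot (medial_graph G) (y, White) = (eseg G y, Black)" for y
    by (simp_all add: rot_def medial_graph_def)
  have out: "half_edge (medial_graph G) (y, a) \<in> D \<longleftrightarrow> y \<in> out_flags D" for y a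
    by (simp add: half_edge_medial out_flags_def)
  note pattern_simps = in_in_out_out_def rot out alternating_defs edge_of_def four_flags[OF G x]
  show ?black ?white
    by (auto simp: pattern_simps)
qed

lemma vertex_flags_medial_vertex: "vertex_flags (medial_vertex e) = e \<times> UNIV"
  by (simp add: vertex_flags_def medial_vertex_def)

lemma edgesD:
  assumes "is_ribbon_graph G" "e \<in> edges G" "x \<in> e"
  shows "x \<in> flags G" "edge_of G x = e"
proof -
  obtain y where y: "y \<in> flags G" and e: "e = edge_of G y" using assms(2) by (auto simp: edges_def)
  show "x \<in> flags G" "edge_of G x = e"
    using edge_of_cong[OF assms(1) y] assms(3) by (simp_all add: e)
qed

lemma self_in_edge_of: "x \<in> edge_of G x"
  by (simp add: edge_of_def)

lemma flags_eq_Union_edges: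
  assumes "is_ribbon_graph G"
  shows "flags G = \<Union> (edges G)"
  using edgesD(1)[OF assms] by (auto simp: edges_def intro: self_in_edge_of)

context
  fixes G :: "('f, 'v) ribbon_graph" and e :: "'f set"
  assumes G: "is_ribbon_graph G" and e: "e \<in> edges G"
begin

private lemmas edge_flagD = edgesD[OF G e]

private lemma ex_notin_of_complements_on_edge:
  assumes "complements_on e (cseg G) Q \<or> complements_on e (eseg G) Q"
  shows "\<exists>x\<in>e. x \<notin> Q"
  using e assms by (auto simp: edges_def edge_of_def complements_on_def)

lemma c_vertex_medial_iff:
  "c_vertex G D (medial_vertex e) \<longleftrightarrow> alternates_on e (cseg G) (eseg G) (out_flags D)"
proof -
  have "c_vertex G D (medial_vertex e) \<longleftrightarrow> (\<exists>x\<in>e. in_in_out_out (medial_graph G) D (x, Black))"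
    unfolding c_vertex_def vertex_flags_medial_vertex
    using edge_flagD(1) by (auto simp: checkerboard)
  also have "\<dots> \<longleftrightarrow> alternates_on e (cseg G) (eseg G) (out_flags D)"
    using ex_notin_of_complements_on_edge
    by (auto simp: in_in_out_out_medial_iff[OF G] edge_flagD alternates_on_def)
  finally show ?thesis .
qed

lemma d_vertex_medial_iff:
  "d_vertex G D (medial_vertex e) \<longleftrightarrow> alternates_on e (eseg G) (cseg G) (out_flags D)"
proof -
  have "d_vertex G D (medial_vertex e) \<longleftrightarrow> (\<exists>x\<in>e. in_in_out_out (medial_graph G) D (x, White))"
    unfolding d_vertex_def vertex_flags_medial_vertex
    using edge_flagD(1) by (auto simp: checkerboard)
  also have "\<dots> \<longleftrightarrow> alternates_on e (eseg G) (cseg G) (out_flags D)"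
    using ex_notin_of_complements_on_edge
    by (auto simp: in_in_out_out_medial_iff[OF G] edge_flagD alternates_on_def)
  finally show ?thesis .
qed

lemma t_vertex_medial_iff:
  "t_vertex G D (medial_vertex e) \<longleftrightarrow>
    preserves_on e (cseg G) (out_flags D) \<and> preserves_on e (eseg G) (out_flags D)"
proof -
  obtain x where x: "x \<in> flags G" and e_eq: "e = edge_of G x" using e by (auto simp: edges_def)
  have "t_vertex G D (medial_vertex e) \<longleftrightarrow> (\<forall>y\<in>e. y \<notin> out_flags D) \<or> (\<forall>y\<in>e. y \<in> out_flags D)"
    unfolding t_vertex_def all_in_or_all_out_def vertex_flags_medial_vertex
    by (auto simp: half_edge_medial out_flags_def)
  also have "\<dots> \<longleftrightarrow> preserves_on e (cseg G) (out_flags D) \<and> preserves_on e (eseg G) (out_flags D)"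
    unfolding e_eq edge_of_def preserves_on_def by (auto simp: four_flags[OF G x])
  finally show ?thesis .
qed

lemma in_in_out_out_medial_vertex_iff:
  "(\<exists>y\<in>vertex_flags (medial_vertex e :: _ + 'v). in_in_out_out (medial_graph G) D y) \<longleftrightarrow>
    c_vertex G D (medial_vertex e) \<or> d_vertex G D (medial_vertex e)"
proof -
  have bex: "(\<exists>y\<in>e \<times> UNIV. R y) \<longleftrightarrow> (\<exists>x\<in>e. R (x, Black) \<or> R (x, White))" for R
    by (auto; metis (full_types) colour.exhaust)
  show ?thesis
    unfolding c_vertex_def d_vertex_def vertex_flags_medial_vertex bex
    using edge_flagD(1) by (auto simp: checkerboard)
qed

lemma preserves_on_edge_iff:
  "preserves_on e (cseg G) Q \<longleftrightarrow>
    alternates_on e (cseg G) (eseg G) Q \<or> preserves_on e (cseg G) Q \<and> preserves_on e (eseg G) Q"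
    (is ?common)
  "preserves_on e (eseg G) Q \<longleftrightarrow>
    alternates_on e (eseg G) (cseg G) Q \<or> preserves_on e (cseg G) Q \<and> preserves_on e (eseg G) Q"
    (is ?edge)
proof -
  obtain x where x: "x \<in> flags G" and e_eq: "e = edge_of G x" using e by (auto simp: edges_def)
  show ?common ?edge
    unfolding e_eq edge_of_def alternating_defs by (auto simp: four_flags[OF G x])
qed

end

section \<open>Directions compatible with a set of edges\<close>

lemma crossing_total_direction_iff:
  assumes G: "is_ribbon_graph G"
  shows "crossing_total_direction G D \<longleftrightarrow> direction (medial_graph G) D \<and>
    edges G = c_edges G D \<union> d_edges G D \<union> t_edges G D"
  unfolding crossing_total_direction_def verts_medial[OF G]
  by (auto simp: c_edges_def d_edges_def t_edges_def in_in_out_out_medial_vertex_iff[OF G]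
      t_vertex_def)

lemma c_edges_Un_t_edges:
  assumes G: "is_ribbon_graph G"
  shows "c_edges G D \<union> t_edges G D = {e \<in> edges G. preserves_on e (cseg G) (out_flags D)}"
  unfolding c_edges_def t_edges_def
  using preserves_on_edge_iff(1)[OF G] c_vertex_medial_iff[OF G] t_vertex_medial_iff[OF G] by blast

lemma d_edges_Un_t_edges:
  assumes G: "is_ribbon_graph G"
  shows "d_edges G D \<union> t_edges G D = {e \<in> edges G. preserves_on e (eseg G) (out_flags D)}"
  unfolding d_edges_def t_edges_def
  using preserves_on_edge_iff(2)[OF G] d_vertex_medial_iff[OF G] t_vertex_medial_iff[OF G] by blast

lemma d_edges_disjoint_c_t_edges:
  assumes G: "is_ribbon_graph G"
  shows "d_edges G D \<inter> (c_edges G D \<union> t_edges G D) = {}"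
proof -
  have "\<not> (complements_on e (cseg G) Q \<and> preserves_on e (cseg G) Q)" if "e \<in> edges G" for e Q
  proof -
    from that obtain x where "x \<in> e" by (auto simp: edges_def edge_of_def)
    then show ?thesis by (auto simp: complements_on_def preserves_on_def)
  qed
  then show ?thesis
    unfolding c_edges_Un_t_edges[OF G]
    by (auto simp: d_edges_def d_vertex_medial_iff[OF G] alternates_on_def)
qed

lemma crossing_total_direction_compatible_iff:
  assumes G: "is_ribbon_graph G" and A: "A \<subseteq> edges G"
  shows "crossing_total_direction G D \<and> (\<exists>S. S \<subseteq> t_edges G D \<and> A = d_edges G D \<union> S) \<longleftrightarrow>
    direction (medial_graph G) D \<and> A \<subseteq> d_edges G D \<union> t_edges G D \<and>
    edges G - A \<subseteq> c_edges G D \<union> t_edges G D"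
    (is "?compatible \<longleftrightarrow> ?D \<and> ?on_A \<and> ?off_A")
proof
  assume ?compatible
  then show "?D \<and> ?on_A \<and> ?off_A" unfolding crossing_total_direction_iff[OF G] by blast
next
  assume edge_types: "?D \<and> ?on_A \<and> ?off_A"
  have subset_edges: "c_edges G D \<subseteq> edges G" "d_edges G D \<subseteq> edges G" "t_edges G D \<subseteq> edges G"
    by (auto simp: c_edges_def d_edges_def t_edges_def)
  have "d_edges G D \<subseteq> A" using edge_types subset_edges(2) d_edges_disjoint_c_t_edges[OF G] by blast
  then have "A - d_edges G D \<subseteq> t_edges G D" "A = d_edges G D \<union> (A - d_edges G D)"
    using edge_types by blast+
  moreover have "edges G = c_edges G D \<union> d_edges G D \<union> t_edges G D"
    using edge_types subset_edges by blast
  ultimately show ?compatible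
    using edge_types unfolding crossing_total_direction_iff[OF G] by blast
qed

lemma preserves_on_cseg_partial_dual_iff:
  assumes G: "is_ribbon_graph G" and A: "A \<subseteq> edges G"
  shows "preserves_on (flags G) (cseg (partial_dual G T A)) (out_flags D) \<longleftrightarrow>
    A \<subseteq> d_edges G D \<union> t_edges G D \<and> edges G - A \<subseteq> c_edges G D \<union> t_edges G D"
proof -
  have "preserves_on (flags G) (cseg (partial_dual G T A)) (out_flags D) \<longleftrightarrow>
      (\<forall>e\<in>edges G. preserves_on e (cseg (partial_dual G T A)) (out_flags D))"
    unfolding flags_eq_Union_edges[OF G] preserves_on_def by blast
  also have "\<dots> \<longleftrightarrow>
      (\<forall>e\<in>edges G. preserves_on e (if e \<in> A then eseg G else cseg G) (out_flags D))"
    by (intro ball_cong refl) (simp add: preserves_on_def edgesD[OF G])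
  also have "\<dots> \<longleftrightarrow> A \<subseteq> d_edges G D \<union> t_edges G D \<and> edges G - A \<subseteq> c_edges G D \<union> t_edges G D"
    unfolding c_edges_Un_t_edges[OF G] d_edges_Un_t_edges[OF G] using A by auto
  finally show ?thesis .
qed

theorem theorem1p4:
  fixes G :: "('f, 'v) ribbon_graph" and A :: "'f set set" and T :: "'f set"
  assumes "is_ribbon_graph G"
    and "A \<subseteq> edges G"
    and "edge_orientation G T"
  shows "eulerian (partial_dual G T A) \<longleftrightarrow>
    (\<exists>D. crossing_total_direction G D \<and>
         (\<exists>S. S \<subseteq> t_edges G D \<and> A = d_edges G D \<union> S))"
proof -
  let ?H = "partial_dual G T A"
  have H: "is_ribbon_graph ?H" using assms(1,3) by (rule is_ribbon_graph_partial_dual)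
  then have p: "pairing_on (flags G) (cseg ?H)" by (simp add: is_ribbon_graph_def)
  have "eulerian ?H \<longleftrightarrow> (\<exists>Q. alternates_on (flags G) (cseg ?H) (vseg G) Q)"
    using eulerian_iff_ex_alternates_on[OF H] by simp
  also have "\<dots> \<longleftrightarrow>
      (\<exists>D. direction (medial_graph G) D \<and> preserves_on (flags G) (cseg ?H) (out_flags D))"
    using ex_direction_preserving_iff[OF assms(1) p] by (rule sym)
  also have "\<dots> \<longleftrightarrow> (\<exists>D. crossing_total_direction G D \<and>
      (\<exists>S. S \<subseteq> t_edges G D \<and> A = d_edges G D \<union> S))"
    unfolding crossing_total_direction_compatible_iff[OF assms(1,2)]
      preserves_on_cseg_partial_dual_iff[OF assms(1,2)] ..
  finally show ?thesis .
qed

end
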